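(* For all positive integers $d,k$ the limit $$\xi_{d,k}:=\lim_{n\to\infty}(\Xi_{dn,kn})^{1/(dn+kn)}\in[1,\infty]$$ exists. Moreover, this limit depends only on the ratio $d/k$, and it is bounded from below by $(\Xi_{d,k})^{1/(d+k)}$.
   Context: For positive integers $d,k$, $\Xi_{d,k}$ denotes the maximal possible number of non-degenerate solutions in $\mathbb R_{>0}^d$ of a polynomial system $f_1=\dots=f_d=0$ with $f_1,\dots,f_d\in\mathbb R[X_1,\dots,X_d]$ that involves altogether at most $d+k+1$ distinct monomials with nonzero coefficients (this maximum is finite). Non-degenerate means that the Jacobian matrix of the system is invertible at the solution. *)

theory Defs
  imports
    "HOL-Analysis.Analysis"
    "HOL-Library.Poly_Mapping"
    "HOL-Library.Extended_Nat"
    "HOL-Library.Extended_Real"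
    "Jordan_Normal_Form.Matrix"
begin

text \<open>
  Monomials are exponent vectors with finite support, and real polynomials are finitely supported
  families of coefficients indexed by monomials (with the ring structure of
  \<^theory>\<open>HOL-Library.Poly_Mapping\<close>). The variables \<open>X\<^sub>1, \<dots>, X\<^sub>d\<close> are numbered \<open>0, \<dots>, d - 1\<close>.
\<close>

type_synonym real_mpoly = "(nat \<Rightarrow>\<^sub>0 nat) \<Rightarrow>\<^sub>0 real"

definition mpolys_in :: "nat \<Rightarrow> real_mpoly set" where
  "mpolys_in d = {p. \<forall>m\<in>Poly_Mapping.keys p. Poly_Mapping.keys m \<subseteq> {..<d}}"

definition mpoly_eval :: "real_mpoly \<Rightarrow> (nat \<Rightarrow> real) \<Rightarrow> real" where
  "mpoly_eval p x =
     (\<Sum>m\<in>Poly_Mapping.keys p. Poly_Mapping.lookup p m *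
        (\<Prod>i\<in>Poly_Mapping.keys m. x i ^ Poly_Mapping.lookup m i))"

text \<open>The points of the open positive orthant are extensional functions, so that distinct functions
  are distinct points.\<close>

definition pos_orthant :: "nat \<Rightarrow> (nat \<Rightarrow> real) set" where
  "pos_orthant d = {..<d} \<rightarrow>\<^sub>E {0<..}"

text \<open>A system of \<open>d\<close> polynomials is a function \<open>F\<close> of which only the values at indices
  below \<open>d\<close> matter.\<close>

definition jacobian_mat :: "nat \<Rightarrow> (nat \<Rightarrow> real_mpoly) \<Rightarrow> (nat \<Rightarrow> real) \<Rightarrow> real mat" where
  "jacobian_mat d F x =
     Matrix.mat d d (\<lambda>(i, j). deriv (\<lambda>t. mpoly_eval (F i) (x(j := t))) (x j))"

definition nondeg_pos_solutions :: "nat \<Rightarrow> (nat \<Rightarrow> real_mpoly) \<Rightarrow> (nat \<Rightarrow> real) set" where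
  "nondeg_pos_solutions d F =
     {x \<in> pos_orthant d. (\<forall>i<d. mpoly_eval (F i) x = 0) \<and> invertible_mat (jacobian_mat d F x)}"

definition fewnomial_systems :: "nat \<Rightarrow> nat \<Rightarrow> (nat \<Rightarrow> real_mpoly) set" where
  "fewnomial_systems d k =
     {F. (\<forall>i<d. F i \<in> mpolys_in d) \<and> card (\<Union>i<d. Poly_Mapping.keys (F i)) \<le> d + k + 1}"

definition ecard :: "'a set \<Rightarrow> enat" where
  "ecard A = (if finite A then enat (card A) else \<infinity>)"

text \<open>The maximum is taken as a supremum in the extended naturals, so that the definition does not
  presuppose Khovanskii's theorem that it is finite. By \<open>Xi_attained\<close> below, a finite value is a
  maximum.\<close>

definition Xi :: "nat \<Rightarrow> nat \<Rightarrow> enat" where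
  "Xi d k = (SUP F\<in>fewnomial_systems d k. ecard (nondeg_pos_solutions d F))"

lemma Xi_attained:
  assumes "Xi d k \<noteq> \<infinity>"
  shows "\<exists>F\<in>fewnomial_systems d k.
           finite (nondeg_pos_solutions d F) \<and> Xi d k = enat (card (nondeg_pos_solutions d F))"
proof -
  let ?A = "(\<lambda>F. ecard (nondeg_pos_solutions d F)) ` fewnomial_systems d k"
  have "(\<lambda>_. 0) \<in> fewnomial_systems d k"
    by (simp add: fewnomial_systems_def mpolys_in_def)
  then have ne: "?A \<noteq> {}" by blast
  have "finite ?A"
    using assms ne by (auto simp: Xi_def Sup_enat_def split: if_splits)
  then have "Xi d k \<in> ?A"
    using ne Max_in[of ?A] by (auto simp: Xi_def Sup_enat_def)
  then show ?thesis
    using assms by (auto simp: ecard_def split: if_splits)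
qed

definition enat_root :: "nat \<Rightarrow> enat \<Rightarrow> ereal" where
  "enat_root m N = (case N of enat a \<Rightarrow> ereal (real a powr (1 / real m)) | \<infinity> \<Rightarrow> \<infinity>)"

definition Xi_root_seq :: "nat \<Rightarrow> nat \<Rightarrow> nat \<Rightarrow> ereal" where
  "Xi_root_seq d k n = enat_root (d * n + k * n) (Xi (d * n) (k * n))"

definition xi :: "nat \<Rightarrow> nat \<Rightarrow> ereal" where
  "xi d k = lim (Xi_root_seq d k)"

end

theory Submission
  imports Defs
begin

text \<open>
  Placing a system in \<open>d\<close> variables next to one in \<open>d'\<close> further variables multiplies the numbers of
  non-degenerate solutions, since the Jacobian becomes block diagonal. Multiplying the equations of
  each system by a monomial occurring in the other one makes the two supports overlap in a monomial
  and changes neither the positive solutions nor their non-degeneracy, so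
  \<open>\<Xi>\<^bsub>d,k\<^esub> \<Xi>\<^bsub>d',k'\<^esub> \<le> \<Xi>\<^bsub>d+d',k+k'\<^esub>\<close>. As \<open>\<Xi>\<^bsub>d,k\<^esub> \<ge> 1\<close> (consider \<open>X\<^sub>i = 1\<close>), Fekete's lemma in multiplicative
  form gives convergence to the supremum of the sequence. This works for infinite values too, so
  Khovanskii's theorem is not needed. For proportional pairs, the two sequences have a common
  subsequence.
\<close>

subsection \<open>Monomials and their relabelling\<close>

definition monom_eval :: "(nat \<Rightarrow>\<^sub>0 nat) \<Rightarrow> (nat \<Rightarrow> real) \<Rightarrow> real" where
  "monom_eval m x = (\<Prod>i\<in>Poly_Mapping.keys m. x i ^ Poly_Mapping.lookup m i)"

lemma mpoly_eval_monom_eval: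
  "mpoly_eval p x = (\<Sum>m\<in>Poly_Mapping.keys p. Poly_Mapping.lookup p m * monom_eval m x)"
  by (simp add: mpoly_eval_def monom_eval_def)

text \<open>Indices outside the support have exponent 0 and contribute the factor 1. Two monomials
  can thus be evaluated over one common index set.\<close>

lemma monom_eval_superset:
  assumes "finite A" "Poly_Mapping.keys m \<subseteq> A"
  shows "monom_eval m x = (\<Prod>i\<in>A. x i ^ Poly_Mapping.lookup m i)"
  unfolding monom_eval_def
  by (rule prod.mono_neutral_left) (use assms in \<open>auto simp: in_keys_iff\<close>)

lemma monom_eval_add: "monom_eval (m + n) x = monom_eval m x * monom_eval n x"
proof -
  let ?A = "Poly_Mapping.keys m \<union> Poly_Mapping.keys n"
  have "monom_eval (m + n) x = (\<Prod>i\<in>?A. x i ^ Poly_Mapping.lookup (m + n) i)"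
    by (rule monom_eval_superset) (use keys_add[of m n] in auto)
  also have "\<dots> = (\<Prod>i\<in>?A. x i ^ Poly_Mapping.lookup m i) * (\<Prod>i\<in>?A. x i ^ Poly_Mapping.lookup n i)"
    by (simp add: lookup_add power_add prod.distrib)
  also have "\<dots> = monom_eval m x * monom_eval n x"
    by (simp add: monom_eval_superset[of ?A])
  finally show ?thesis .
qed

lemma monom_eval_cong:
  assumes "\<And>i. i \<in> Poly_Mapping.keys m \<Longrightarrow> x i = y i"
  shows "monom_eval m x = monom_eval m y"
  unfolding monom_eval_def by (rule prod.cong) (use assms in auto)

lemma monom_eval_pos:
  assumes "\<And>i. i \<in> Poly_Mapping.keys m \<Longrightarrow> x i > 0"
  shows "monom_eval m x > 0"
  unfolding monom_eval_def by (rule prod_pos) (use assms in auto)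

text \<open>A polynomial of the first system does not see the later coordinates of a point; this is
  how it is evaluated at a glued point.\<close>

lemma mpoly_eval_cong:
  assumes "p \<in> mpolys_in d" "\<And>i. i < d \<Longrightarrow> x i = y i"
  shows "mpoly_eval p x = mpoly_eval p y"
  unfolding mpoly_eval_monom_eval
  by (intro sum.cong refl arg_cong2[of _ _ _ _ "(*)"] monom_eval_cong)
    (use assms in \<open>auto simp: mpolys_in_def\<close>)

lemma field_differentiable_monom_eval_upd:
  "(\<lambda>t. monom_eval m (x(j := t))) field_differentiable (at u)"
proof -
  \<comment> \<open>The index set and the exponents are detached from \<open>m\<close>, so that
    induction on the index set is possible.\<close>
  have "(\<lambda>t. \<Prod>i\<in>A. (x(j := t)) i ^ n i) field_differentiable (at u)" if "finite A" for A and n :: "nat \<Rightarrow> nat"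
    using that
  proof (induction A)
    case (insert a A)
    have "(\<lambda>t. (x(j := t)) a ^ n a) field_differentiable (at u)"
      by (cases "a = j") (auto intro!: derivative_intros)
    with insert show ?case
      by (auto intro: field_differentiable_mult simp del: fun_upd_apply)
  qed auto
  then show ?thesis
    by (simp add: monom_eval_def del: fun_upd_apply)
qed

text \<open>Differentiability is what allows a constant factor to be pulled out of
  \<open>deriv\<close> in the Jacobian.\<close>

lemma field_differentiable_mpoly_eval_upd:
  "(\<lambda>t. mpoly_eval p (x(j := t))) field_differentiable (at u)"
  unfolding mpoly_eval_monom_eval
  by (intro derivative_intros field_differentiable_monom_eval_upd)

text \<open>Moves a monomial of the second system past the first \<open>d\<close> variables, so that
  the two systems use disjoint sets of variables.\<close>

definition shift_monom :: "nat \<Rightarrow> (nat \<Rightarrow>\<^sub>0 nat) \<Rightarrow> (nat \<Rightarrow>\<^sub>0 nat)" where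
  "shift_monom d m =
     Poly_Mapping.Abs_poly_mapping (\<lambda>j. if j < d then 0 else Poly_Mapping.lookup m (j - d))"

lemma lookup_shift_monom:
  "Poly_Mapping.lookup (shift_monom d m) j = (if j < d then 0 else Poly_Mapping.lookup m (j - d))"
proof -
  have "{j. (if j < d then 0 else Poly_Mapping.lookup m (j - d)) \<noteq> 0} \<subseteq> (+) d ` Poly_Mapping.keys m"
    by (force simp: in_keys_iff image_iff split: if_splits)
  then have "finite {j. (if j < d then 0 else Poly_Mapping.lookup m (j - d)) \<noteq> 0}"
    by (rule finite_subset) simp
  then show ?thesis
    by (simp add: shift_monom_def)
qed

lemma keys_shift_monom: "Poly_Mapping.keys (shift_monom d m) = (+) d ` Poly_Mapping.keys m"
proof (intro equalityI subsetI)
  fix j assume "j \<in> Poly_Mapping.keys (shift_monom d m)"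
  then have "d \<le> j" "j - d \<in> Poly_Mapping.keys m"
    by (auto simp: in_keys_iff lookup_shift_monom split: if_splits)
  then show "j \<in> (+) d ` Poly_Mapping.keys m"
    by (metis image_eqI le_add_diff_inverse)
qed (auto simp: in_keys_iff lookup_shift_monom)

lemma inj_shift_monom: "inj (shift_monom d)"
proof (rule injI, rule poly_mapping_eqI)
  fix m n i assume "shift_monom d m = shift_monom d n"
  then have "Poly_Mapping.lookup (shift_monom d m) (d + i) = Poly_Mapping.lookup (shift_monom d n) (d + i)"
    by simp
  then show "Poly_Mapping.lookup m i = Poly_Mapping.lookup n i"
    by (simp add: lookup_shift_monom)
qed

lemma monom_eval_shift: "monom_eval (shift_monom d m) x = monom_eval m (\<lambda>i. x (d + i))"
  by (simp add: monom_eval_def keys_shift_monom prod.reindex lookup_shift_monom)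

text \<open>Renaming variables and multiplying by a fixed monomial are both injective maps
  \<open>T\<close> on monomials, so one operation covers the two. For injective \<open>T\<close> no
  terms merge, and the number of monomials is preserved.\<close>

definition relabel :: "((nat \<Rightarrow>\<^sub>0 nat) \<Rightarrow> (nat \<Rightarrow>\<^sub>0 nat)) \<Rightarrow> real_mpoly \<Rightarrow> real_mpoly" where
  "relabel T p = (\<Sum>m\<in>Poly_Mapping.keys p. Poly_Mapping.single (T m) (Poly_Mapping.lookup p m))"

lemma lookup_relabel:
  assumes "inj T"
  shows "Poly_Mapping.lookup (relabel T p) (T m) = Poly_Mapping.lookup p m"
proof -
  have "Poly_Mapping.lookup (relabel T p) (T m) =
      (\<Sum>n\<in>Poly_Mapping.keys p. if n = m then Poly_Mapping.lookup p n else 0)"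
    unfolding relabel_def lookup_sum
    by (rule sum.cong) (auto simp: lookup_single when_def inj_eq[OF assms])
  then show ?thesis
    by (simp add: in_keys_iff)
qed

lemma keys_relabel:
  assumes "inj T"
  shows "Poly_Mapping.keys (relabel T p) = T ` Poly_Mapping.keys p"
proof
  show "Poly_Mapping.keys (relabel T p) \<subseteq> T ` Poly_Mapping.keys p"
  proof
    fix n assume n: "n \<in> Poly_Mapping.keys (relabel T p)"
    show "n \<in> T ` Poly_Mapping.keys p"
    proof (rule ccontr)
      assume "n \<notin> T ` Poly_Mapping.keys p"
      then have "Poly_Mapping.lookup (relabel T p) n = 0"
        by (auto simp: relabel_def lookup_sum lookup_single when_def intro!: sum.neutral)
      with n show False
        by (simp add: in_keys_iff)
    qed
  qed
qed (auto simp: in_keys_iff lookup_relabel[OF assms])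

text \<open>The rule for monomials extends linearly. In the applications \<open>c\<close> is the
  value of the monomial by which the polynomial is multiplied.\<close>

lemma mpoly_eval_relabel:
  assumes "inj T" "\<And>m. m \<in> Poly_Mapping.keys p \<Longrightarrow> monom_eval (T m) z = c * monom_eval m x"
  shows "mpoly_eval (relabel T p) z = c * mpoly_eval p x"
proof -
  have "inj_on T (Poly_Mapping.keys p)"
    using assms(1) by (rule inj_on_subset) simp
  then have "mpoly_eval (relabel T p) z =
      (\<Sum>m\<in>Poly_Mapping.keys p. Poly_Mapping.lookup p m * monom_eval (T m) z)"
    by (simp add: mpoly_eval_monom_eval keys_relabel[OF assms(1)] sum.reindex lookup_relabel[OF assms(1)])
  then show ?thesis
    by (simp add: assms(2) mpoly_eval_monom_eval sum_distrib_left mult_ac)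
qed

subsection \<open>Juxtaposition of two systems\<close>

text \<open>Here \<open>a\<close> is meant to be a monomial of \<open>F\<close> and \<open>b\<close>
  one of \<open>G\<close>. Then \<open>a + shift_monom d b\<close> occurs in both halves of the new
  system.\<close>

definition juxtapose ::
  "nat \<Rightarrow> (nat \<Rightarrow>\<^sub>0 nat) \<Rightarrow> (nat \<Rightarrow>\<^sub>0 nat) \<Rightarrow> (nat \<Rightarrow> real_mpoly) \<Rightarrow> (nat \<Rightarrow> real_mpoly) \<Rightarrow> nat \<Rightarrow> real_mpoly"
  where
  "juxtapose d a b F G i =
     (if i < d then relabel (\<lambda>m. m + shift_monom d b) (F i)
      else relabel (\<lambda>m. a + shift_monom d m) (G (i - d)))"

lemma inj_add_shift: "inj (\<lambda>m. m + shift_monom d b)"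
  by (auto intro: injI)

lemma inj_shift_add: "inj (\<lambda>m. a + shift_monom d m)"
  by (rule injI) (simp add: inj_eq[OF inj_shift_monom])

lemma mpoly_eval_juxtapose_left:
  "i < d \<Longrightarrow> mpoly_eval (juxtapose d a b F G i) z = monom_eval b (\<lambda>i. z (d + i)) * mpoly_eval (F i) z"
  by (simp add: juxtapose_def mpoly_eval_relabel[OF inj_add_shift] monom_eval_add monom_eval_shift)

lemma mpoly_eval_juxtapose_right:
  "mpoly_eval (juxtapose d a b F G (d + i)) z = monom_eval a z * mpoly_eval (G i) (\<lambda>i. z (d + i))"
  by (simp add: juxtapose_def mpoly_eval_relabel[OF inj_shift_add] monom_eval_add monom_eval_shift)

lemma keys_juxtapose:
  "(\<Union>i<d + d'. Poly_Mapping.keys (juxtapose d a b F G i)) =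
     (\<lambda>m. m + shift_monom d b) ` (\<Union>i<d. Poly_Mapping.keys (F i)) \<union>
     (\<lambda>m. a + shift_monom d m) ` (\<Union>i<d'. Poly_Mapping.keys (G i))"
proof -
  have "(+) d ` {..<d'} = {d..<d + d'}"
    using image_add_atLeastLessThan[of d 0 d'] by (simp add: lessThan_atLeast0 add.commute)
  then have split: "{..<d + d'} = {..<d} \<union> (+) d ` {..<d'}"
    by auto
  have "(\<Union>i<d. Poly_Mapping.keys (juxtapose d a b F G i)) =
      (\<lambda>m. m + shift_monom d b) ` (\<Union>i<d. Poly_Mapping.keys (F i))"
    unfolding image_UN by (rule SUP_cong) (simp_all add: juxtapose_def keys_relabel[OF inj_add_shift])
  moreover have "(\<Union>i\<in>(+) d ` {..<d'}. Poly_Mapping.keys (juxtapose d a b F G i)) =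
      (\<lambda>m. a + shift_monom d m) ` (\<Union>i<d'. Poly_Mapping.keys (G i))"
    unfolding image_UN image_image
    by (rule SUP_cong) (simp_all add: juxtapose_def keys_relabel[OF inj_shift_add])
  ultimately show ?thesis
    unfolding split UN_Un by (rule arg_cong2)
qed

text \<open>The two halves have at most \<open>d + k + 1\<close> and \<open>d' + k' + 1\<close>
  monomials, one more in total than allowed; the shared monomial \<open>a + shift_monom d b\<close>
  makes up for it. If one support is empty, the other alone is within the bound.\<close>

lemma juxtapose_in_fewnomial_systems:
  assumes F: "F \<in> fewnomial_systems d k" and G: "G \<in> fewnomial_systems d' k'"
    and a: "Poly_Mapping.keys a \<subseteq> {..<d}" and b: "Poly_Mapping.keys b \<subseteq> {..<d'}"
    and common: "(\<Union>i<d. Poly_Mapping.keys (F i)) = {} \<or> (\<Union>i<d'. Poly_Mapping.keys (G i)) = {} \<or>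
      a \<in> (\<Union>i<d. Poly_Mapping.keys (F i)) \<and> b \<in> (\<Union>i<d'. Poly_Mapping.keys (G i))"
  shows "juxtapose d a b F G \<in> fewnomial_systems (d + d') (k + k')"
proof -
  let ?K = "\<Union>i<d. Poly_Mapping.keys (F i)" and ?L = "\<Union>i<d'. Poly_Mapping.keys (G i)"
  let ?S = "\<lambda>m. m + shift_monom d b" and ?T = "\<lambda>m. a + shift_monom d m"
  have mem: "juxtapose d a b F G i \<in> mpolys_in (d + d')" if "i < d + d'" for i
  proof -
    have "Poly_Mapping.keys m \<subseteq> {..<d + d'}" if m: "m \<in> Poly_Mapping.keys (juxtapose d a b F G i)" for m
    proof -
      from m \<open>i < d + d'\<close> have "m \<in> ?S ` ?K \<union> ?T ` ?L"
        unfolding keys_juxtapose[symmetric] by blast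
      then show ?thesis
      proof
        assume "m \<in> ?S ` ?K"
        then obtain n where n: "n \<in> ?K" "m = n + shift_monom d b" by auto
        have "Poly_Mapping.keys n \<subseteq> {..<d}"
          using n(1) F by (auto simp: fewnomial_systems_def mpolys_in_def)
        then show ?thesis
          using n(2) keys_add[of n "shift_monom d b"] b by (fastforce simp: keys_shift_monom)
      next
        assume "m \<in> ?T ` ?L"
        then obtain n where n: "n \<in> ?L" "m = a + shift_monom d n" by auto
        have "Poly_Mapping.keys n \<subseteq> {..<d'}"
          using n(1) G by (auto simp: fewnomial_systems_def mpolys_in_def)
        then show ?thesis
          using n(2) keys_add[of a "shift_monom d n"] a by (fastforce simp: keys_shift_monom)
      qed
    qed
    then show ?thesis
      by (auto simp: mpolys_in_def)
  qed
  have fin: "finite ?K" "finite ?L"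
    by auto
  have cards: "card (?S ` ?K) \<le> d + k + 1" "card (?T ` ?L) \<le> d' + k' + 1"
    using F G card_image_le[OF fin(1), of ?S] card_image_le[OF fin(2), of ?T]
    by (auto simp: fewnomial_systems_def)
  have "card (?S ` ?K \<union> ?T ` ?L) \<le> d + d' + (k + k') + 1"
    using common
  proof (elim disjE conjE)
    assume "a \<in> ?K" "b \<in> ?L"
    then have "a + shift_monom d b \<in> ?S ` ?K \<inter> ?T ` ?L"
      by blast
    then have "card (?S ` ?K \<inter> ?T ` ?L) > 0"
      using fin by (auto simp: card_gt_0_iff)
    moreover have "card (?S ` ?K) + card (?T ` ?L) = card (?S ` ?K \<union> ?T ` ?L) + card (?S ` ?K \<inter> ?T ` ?L)"
      by (rule card_Un_Int) (use fin in auto)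
    ultimately show ?thesis
      using cards by linarith
  next
    assume "?K = {}"
    then have "?S ` ?K \<union> ?T ` ?L = ?T ` ?L"
      by auto
    then have "card (?S ` ?K \<union> ?T ` ?L) = card (?T ` ?L)"
      by (rule arg_cong)
    then show ?thesis
      using cards by linarith
  next
    assume "?L = {}"
    then have "?S ` ?K \<union> ?T ` ?L = ?S ` ?K"
      by auto
    then have "card (?S ` ?K \<union> ?T ` ?L) = card (?S ` ?K)"
      by (rule arg_cong)
    then show ?thesis
      using cards by linarith
  qed
  then have "card (\<Union>i<d + d'. Poly_Mapping.keys (juxtapose d a b F G i)) \<le> d + d' + (k + k') + 1"
    by (simp only: keys_juxtapose)
  with mem show ?thesis
    by (auto simp: fewnomial_systems_def)
qed

section \<open>Invertibility of block diagonal matrices\<close>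

text \<open>\<open>invertible_mat\<close> leaves the dimensions of the inverse open; comparing the
  column numbers in the two product equations determines them.\<close>

lemma invertible_mat_carrierE:
  assumes "A \<in> carrier_mat n n" "invertible_mat A"
  obtains B where "B \<in> carrier_mat n n" "A * B = 1\<^sub>m n" "B * A = 1\<^sub>m n"
proof -
  obtain B where B: "A * B = 1\<^sub>m n" "B * A = 1\<^sub>m (dim_row B)"
    using assms by (auto simp: invertible_mat_def inverts_mat_def)
  have "dim_col (A * B) = n" "dim_col (B * A) = dim_row B"
    unfolding B by simp_all
  then have "B \<in> carrier_mat n n"
    using assms(1) by auto
  with B that show thesis by auto
qed

text \<open>The inverse is block diagonal with blocks \<open>inverse c \<cdot>\<^sub>m A'\<close>
  and \<open>inverse e \<cdot>\<^sub>m B'\<close>. The scalars will be the values of the monomial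
  factors.\<close>

lemma invertible_mat_diag_block:
  fixes A B :: "'a::field mat"
  assumes A: "A \<in> carrier_mat n n" "invertible_mat A" and B: "B \<in> carrier_mat m m" "invertible_mat B"
    and "c \<noteq> 0" "e \<noteq> 0"
  shows "invertible_mat (four_block_mat (c \<cdot>\<^sub>m A) (0\<^sub>m n m) (0\<^sub>m m n) (e \<cdot>\<^sub>m B))" (is "invertible_mat ?M")
proof -
  obtain A' where A': "A' \<in> carrier_mat n n" "A * A' = 1\<^sub>m n" "A' * A = 1\<^sub>m n"
    using A by (rule invertible_mat_carrierE)
  obtain B' where B': "B' \<in> carrier_mat m m" "B * B' = 1\<^sub>m m" "B' * B = 1\<^sub>m m"
    using B by (rule invertible_mat_carrierE)
  let ?N = "four_block_mat (inverse c \<cdot>\<^sub>m A') (0\<^sub>m n m) (0\<^sub>m m n) (inverse e \<cdot>\<^sub>m B')"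
  have scale: "(s \<cdot>\<^sub>m U) * (t \<cdot>\<^sub>m V) = 1\<^sub>m l"
    if "U \<in> carrier_mat l l" "V \<in> carrier_mat l l" "U * V = 1\<^sub>m l" "s * t = 1" for s t :: 'a and U V l
  proof -
    have "(s \<cdot>\<^sub>m U) * (t \<cdot>\<^sub>m V) = (s * t) \<cdot>\<^sub>m (U * V)"
      using that(1,2)
      by (intro eq_matI) (auto simp: mult_smult_distrib[of _ l l _ l] mult_smult_assoc_mat[of _ l l _ l])
    then show ?thesis
      using that by (auto intro!: eq_matI)
  qed
  have 1: "?M * ?N = 1\<^sub>m (n + m)"
    by (subst mult_four_block_mat[where ?nr1.0 = n and ?n1.0 = n and ?n2.0 = m and ?nr2.0 = m and ?nc1.0 = n and ?nc2.0 = m])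
      (use A B A' B' assms(5,6) in \<open>auto simp: scale\<close>)
  have 2: "?N * ?M = 1\<^sub>m (n + m)"
    by (subst mult_four_block_mat[where ?nr1.0 = n and ?n1.0 = n and ?n2.0 = m and ?nr2.0 = m and ?nc1.0 = n and ?nc2.0 = m])
      (use A B A' B' assms(5,6) in \<open>auto simp: scale\<close>)
  show ?thesis
    unfolding invertible_mat_def inverts_mat_def
    using 1 2 A B A' B' by (auto intro!: exI[of _ ?N])
qed

section \<open>Gluing non-degenerate solutions\<close>

text \<open>From \<open>d + d'\<close> on, the value is that of \<open>y\<close> outside its domain,
  so extensionality of the glued point is inherited from \<open>y\<close>.\<close>

definition glue_points :: "nat \<Rightarrow> (nat \<Rightarrow> real) \<Rightarrow> (nat \<Rightarrow> real) \<Rightarrow> nat \<Rightarrow> real" where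
  "glue_points d x y i = (if i < d then x i else y (i - d))"

lemma glue_points_right [simp]: "(\<lambda>i. glue_points d x y (d + i)) = y"
  by (auto simp: glue_points_def)

lemma glue_points_in_pos_orthant:
  "x \<in> pos_orthant d \<Longrightarrow> y \<in> pos_orthant d' \<Longrightarrow> glue_points d x y \<in> pos_orthant (d + d')"
  by (auto simp: pos_orthant_def glue_points_def PiE_def Pi_def extensional_def)

text \<open>All of \<open>y\<close> and the values of \<open>x\<close> below \<open>d\<close> can be
  read off; the other values of \<open>x\<close> are fixed by extensionality. Hence \<open>Y\<close>
  may be arbitrary.\<close>

lemma inj_on_glue_points:
  "inj_on (\<lambda>(x, y). glue_points d x y) (pos_orthant d \<times> Y)"
proof (rule inj_onI, clarify)
  fix x y x' y' assume x: "x \<in> pos_orthant d" "x' \<in> pos_orthant d" and eq: "glue_points d x y = glue_points d x' y'"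
  have "x i = x' i" for i
    using x fun_cong[OF eq, of i] by (cases "i < d") (auto simp: glue_points_def pos_orthant_def PiE_def extensional_def)
  moreover have "y i = y' i" for i
    using fun_cong[OF eq, of "d + i"] by (simp add: glue_points_def)
  ultimately show "x = x' \<and> y = y'"
    by blast
qed

text \<open>Each equation is a monomial in one group of variables times a polynomial in the other
  group. In a diagonal block the monomial stays constant and comes out of the derivative. Off the
  diagonal the polynomial factor stays at its value 0, so the differentiated function vanishes
  identically.\<close>

lemma jacobian_juxtapose:
  assumes F: "\<forall>i<d. F i \<in> mpolys_in d" and a: "Poly_Mapping.keys a \<subseteq> {..<d}"
    and F0: "\<forall>i<d. mpoly_eval (F i) x = 0" and G0: "\<forall>i<d'. mpoly_eval (G i) y = 0"
  shows "jacobian_mat (d + d') (juxtapose d a b F G) (glue_points d x y) =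
    four_block_mat (monom_eval b y \<cdot>\<^sub>m jacobian_mat d F x) (0\<^sub>m d d') (0\<^sub>m d' d)
      (monom_eval a x \<cdot>\<^sub>m jacobian_mat d' G y)" (is "?J = ?M")
proof (rule eq_matI)
  let ?z = "glue_points d x y"
  let ?H = "juxtapose d a b F G"
  have upd_left: "(\<lambda>i. (?z(j := t)) (d + i)) = y" if "j < d" for j t
    using that by (auto simp: glue_points_def)
  have upd_right: "(\<lambda>i. (?z(d + j := t)) (d + i)) = y(j := t)" for j t
    by (auto simp: glue_points_def)
  have F_left: "mpoly_eval (F i) (?z(j := t)) = mpoly_eval (F i) (x(j := t))" if "i < d" "j < d" for i j t
    by (rule mpoly_eval_cong[of _ d]) (use F that in \<open>auto simp: glue_points_def\<close>)
  have F_right: "mpoly_eval (F i) (?z(d + j := t)) = mpoly_eval (F i) x" if "i < d" for i j t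
    by (rule mpoly_eval_cong[of _ d]) (use F that in \<open>auto simp: glue_points_def\<close>)
  have a_right: "monom_eval a (?z(d + j := t)) = monom_eval a x" for j t
    by (rule monom_eval_cong) (use a in \<open>auto simp: glue_points_def\<close>)
  note upd = upd_left upd_right F_left F_right a_right
  fix i j assume "i < dim_row ?M" "j < dim_col ?M"
  then have ij: "i < d + d'" "j < d + d'"
    by (auto simp: jacobian_mat_def)
  then have J: "?J $$ (i, j) = deriv (\<lambda>t. mpoly_eval (?H i) (?z(j := t))) (?z j)"
    by (simp add: jacobian_mat_def)
  show "?J $$ (i, j) = ?M $$ (i, j)"
  proof (cases "i < d")
    case i: True
    show ?thesis
    proof (cases "j < d")
      case True
      then show ?thesis
        using i by (simp add: J jacobian_mat_def mpoly_eval_juxtapose_left upd deriv_cmult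
            field_differentiable_mpoly_eval_upd glue_points_def del: fun_upd_apply)
    next
      case False
      then obtain j' where j': "j = d + j'" "j' < d'"
        using ij by (metis add_diff_inverse_nat nat_add_left_cancel_less)
      then show ?thesis
        using i F0 by (simp add: J jacobian_mat_def mpoly_eval_juxtapose_left upd del: fun_upd_apply)
    qed
  next
    case False
    then obtain i' where i': "i = d + i'" "i' < d'"
      using ij by (metis add_diff_inverse_nat nat_add_left_cancel_less)
    show ?thesis
    proof (cases "j < d")
      case True
      then show ?thesis
        using i' G0 by (simp add: J jacobian_mat_def mpoly_eval_juxtapose_right upd del: fun_upd_apply)
    next
      case False
      then obtain j' where j': "j = d + j'" "j' < d'"
        using ij by (metis add_diff_inverse_nat nat_add_left_cancel_less)
      have "?z (d + j') = y j'"
        by (simp add: glue_points_def)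
      then show ?thesis
        using i' j' by (simp add: J jacobian_mat_def mpoly_eval_juxtapose_right upd deriv_cmult
            field_differentiable_mpoly_eval_upd del: fun_upd_apply)
    qed
  qed
qed (auto simp: jacobian_mat_def)

text \<open>Monomials are positive on the open orthant, so the scalars in the block diagonal
  Jacobian are nonzero.\<close>

lemma glue_points_nondeg:
  assumes F: "\<forall>i<d. F i \<in> mpolys_in d"
    and a: "Poly_Mapping.keys a \<subseteq> {..<d}" and b: "Poly_Mapping.keys b \<subseteq> {..<d'}"
    and x: "x \<in> nondeg_pos_solutions d F" and y: "y \<in> nondeg_pos_solutions d' G"
  shows "glue_points d x y \<in> nondeg_pos_solutions (d + d') (juxtapose d a b F G)"
proof -
  let ?z = "glue_points d x y"
  have x': "x \<in> pos_orthant d" "\<forall>i<d. mpoly_eval (F i) x = 0" "invertible_mat (jacobian_mat d F x)"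
    and y': "y \<in> pos_orthant d'" "\<forall>i<d'. mpoly_eval (G i) y = 0" "invertible_mat (jacobian_mat d' G y)"
    using x y by (auto simp: nondeg_pos_solutions_def)
  have "monom_eval a x > 0" "monom_eval b y > 0"
    using a b x'(1) y'(1) by (auto intro!: monom_eval_pos simp: pos_orthant_def PiE_def Pi_def)
  then have "invertible_mat (jacobian_mat (d + d') (juxtapose d a b F G) ?z)"
    unfolding jacobian_juxtapose[OF F a x'(2) y'(2)]
    by (intro invertible_mat_diag_block x' y') (auto simp: jacobian_mat_def)
  moreover have "mpoly_eval (juxtapose d a b F G i) ?z = 0" if "i < d + d'" for i
  proof (cases "i < d")
    case True
    have "mpoly_eval (F i) ?z = mpoly_eval (F i) x"
      by (rule mpoly_eval_cong[of _ d]) (use F True in \<open>auto simp: glue_points_def\<close>)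
    then show ?thesis
      using True x'(2) by (simp add: mpoly_eval_juxtapose_left)
  next
    case False
    then obtain i' where "i = d + i'" "i' < d'"
      using \<open>i < d + d'\<close> by (metis add_diff_inverse_nat nat_add_left_cancel_less)
    then show ?thesis
      using y'(2) by (simp add: mpoly_eval_juxtapose_right)
  qed
  ultimately show ?thesis
    using glue_points_in_pos_orthant[OF x'(1) y'(1)] by (auto simp: nondeg_pos_solutions_def)
qed

subsection \<open>Supermultiplicativity\<close>

lemma ecard_Times_le:
  assumes inj: "inj_on f (A \<times> B)" and sub: "f ` (A \<times> B) \<subseteq> C"
  shows "ecard A * ecard B \<le> ecard C"
proof (cases "finite C")
  case True
  then have fin: "finite (A \<times> B)"
    using inj sub by (meson finite_imageD finite_subset)
  have le: "card A * card B \<le> card C"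
    using card_mono[OF True sub] by (simp add: card_image[OF inj] card_cartesian_product)
  show ?thesis
  \<comment> \<open>A finite product may have an infinite factor if the other one is empty; the left
    side is then 0, since 0 times \<open>\<infinity>\<close> is 0 in \<open>enat\<close>.\<close>
  proof (cases "A = {} \<or> B = {}")
    case False
    then have "finite A" "finite B"
      using fin by (auto simp: finite_cartesian_product_iff)
    then show ?thesis
      using le True by (simp add: ecard_def)
  qed (auto simp: ecard_def zero_enat_def[symmetric])
qed (simp add: ecard_def)

lemma ecard_nondeg_mult_le_Xi:
  assumes F: "F \<in> fewnomial_systems d k" and G: "G \<in> fewnomial_systems d' k'"
  shows "ecard (nondeg_pos_solutions d F) * ecard (nondeg_pos_solutions d' G) \<le> Xi (d + d') (k + k')"
proof -
  let ?K = "\<Union>i<d. Poly_Mapping.keys (F i)" and ?L = "\<Union>i<d'. Poly_Mapping.keys (G i)"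
  \<comment> \<open>The default for an empty support is the constant monomial 0, which involves no
    variables.\<close>
  have pick: "\<exists>a. Poly_Mapping.keys a \<subseteq> {..<e} \<and>
      ((\<Union>i<e. Poly_Mapping.keys (E i)) = {} \<or> a \<in> (\<Union>i<e. Poly_Mapping.keys (E i)))"
    if "E \<in> fewnomial_systems e l" for E e l
  proof (cases "(\<Union>i<e. Poly_Mapping.keys (E i)) = {}")
    case True
    then show ?thesis
      by (intro exI[of _ 0]) simp
  next
    case False
    then obtain a where "a \<in> (\<Union>i<e. Poly_Mapping.keys (E i))"
      by blast
    with that show ?thesis
      by (intro exI[of _ a]) (auto simp: fewnomial_systems_def mpolys_in_def)
  qed
  obtain a where a: "Poly_Mapping.keys a \<subseteq> {..<d}" "?K = {} \<or> a \<in> ?K"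
    using pick[OF F] by blast
  obtain b where b: "Poly_Mapping.keys b \<subseteq> {..<d'}" "?L = {} \<or> b \<in> ?L"
    using pick[OF G] by blast
  let ?H = "juxtapose d a b F G"
  have H: "?H \<in> fewnomial_systems (d + d') (k + k')"
    using juxtapose_in_fewnomial_systems[OF F G a(1) b(1)] a(2) b(2) by argo
  have F': "\<forall>i<d. F i \<in> mpolys_in d"
    using F by (simp add: fewnomial_systems_def)
  have "ecard (nondeg_pos_solutions d F) * ecard (nondeg_pos_solutions d' G) \<le>
      ecard (nondeg_pos_solutions (d + d') ?H)"
  proof (rule ecard_Times_le[where f = "\<lambda>(x, y). glue_points d x y"])
    show "inj_on (\<lambda>(x, y). glue_points d x y) (nondeg_pos_solutions d F \<times> nondeg_pos_solutions d' G)"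
      by (rule inj_on_subset[OF inj_on_glue_points[of d UNIV]]) (auto simp: nondeg_pos_solutions_def)
  qed (use glue_points_nondeg[OF F' a(1) b(1)] in auto)
  also have "\<dots> \<le> Xi (d + d') (k + k')"
    unfolding Xi_def using H by (rule SUP_upper)
  finally show ?thesis .
qed

text \<open>Only finite \<open>c\<close> and \<open>b \<ge> 1\<close> are of interest. Then the
  values of \<open>f\<close> are bounded by \<open>c\<close>, so there are finitely many and the
  supremum is attained.\<close>

lemma SUP_enat_mult_le:
  fixes f :: "'a \<Rightarrow> enat"
  assumes le: "\<And>x. x \<in> A \<Longrightarrow> f x * b \<le> c"
  shows "(SUP x\<in>A. f x) * b \<le> c"
proof (cases "A = {} \<or> b = 0 \<or> c = \<infinity>")
  case True
  then show ?thesis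
    by (auto simp: bot_enat_def)
next
  case False
  then obtain n where n: "c = enat n"
    by auto
  have "1 \<le> b"
    using False by (simp add: ileI1 one_eSuc)
  have "f x \<le> enat n" if "x \<in> A" for x
    using mult_left_mono[OF \<open>1 \<le> b\<close>, of "f x"] le[OF that] n by (auto intro: order_trans)
  then have "finite (f ` A)"
    by (intro finite_enat_bounded[of _ n]) auto
  then have "(SUP x\<in>A. f x) \<in> f ` A"
    using False Max_in[of "f ` A"] by (auto simp: Sup_enat_def)
  then show ?thesis
    using le by auto
qed

text \<open>The bound for a pair of systems passes to the supremum in one factor at a time.\<close>

lemma Xi_supermultiplicative: "Xi d k * Xi d' k' \<le> Xi (d + d') (k + k')"
  unfolding Xi_def[of d k]
proof (rule SUP_enat_mult_le)
  fix F assume F: "F \<in> fewnomial_systems d k"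
  have "Xi d' k' * ecard (nondeg_pos_solutions d F) \<le> Xi (d + d') (k + k')"
    unfolding Xi_def[of d' k']
    by (rule SUP_enat_mult_le, subst mult.commute) (rule ecard_nondeg_mult_le_Xi[OF F])
  then show "ecard (nondeg_pos_solutions d F) * Xi d' k' \<le> Xi (d + d') (k + k')"
    by (simp add: mult.commute)
qed

text \<open>The system of the equations \<open>X_i - 1 = 0\<close> has \<open>d + 1\<close>
  monomials, and its Jacobian is the identity matrix.\<close>

lemma Xi_ge_1: "1 \<le> Xi d k"
proof -
  let ?X = "\<lambda>i. Poly_Mapping.single (Poly_Mapping.single i 1) 1 :: real_mpoly"
  let ?F = "\<lambda>i. ?X i - 1"
  \<comment> \<open>The all-ones point, set to \<open>undefined\<close> from index \<open>d\<close>
    on to be extensional.\<close>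
  let ?x = "\<lambda>i. if i < d then 1 else undefined :: real"
  have keys: "Poly_Mapping.keys (?F i) = {0, Poly_Mapping.single i 1}" for i
  proof -
    have "Poly_Mapping.single i (1::nat) \<noteq> 0"
      by (metis lookup_single_eq lookup_zero zero_neq_one)
    then show ?thesis
      by (auto simp: in_keys_iff lookup_minus lookup_one lookup_single when_def split: if_splits)
  qed
  have eval: "mpoly_eval (?F i) x = x i - 1" for i x
  proof -
    have "Poly_Mapping.single i (1::nat) \<noteq> 0"
      by (metis lookup_single_eq lookup_zero zero_neq_one)
    then show ?thesis
      unfolding mpoly_eval_def keys
      by (simp add: lookup_minus lookup_one lookup_single when_def del: One_nat_def)
  qed
  have "(\<Union>i<d. Poly_Mapping.keys (?F i)) \<subseteq> insert 0 ((\<lambda>i. Poly_Mapping.single i 1) ` {..<d})"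
    unfolding keys by blast
  then have "card (\<Union>i<d. Poly_Mapping.keys (?F i)) \<le> card (insert 0 ((\<lambda>i. Poly_Mapping.single i (1::nat)) ` {..<d}))"
    by (rule card_mono[rotated]) simp
  also have "\<dots> \<le> Suc (card ((\<lambda>i. Poly_Mapping.single i (1::nat)) ` {..<d}))"
    by (rule card_insert_le_m1) auto
  also have "\<dots> \<le> d + k + 1"
    using card_image_le[of "{..<d}" "\<lambda>i. Poly_Mapping.single i (1::nat)"] by simp
  finally have F: "?F \<in> fewnomial_systems d k"
    by (auto simp: fewnomial_systems_def mpolys_in_def keys simp del: One_nat_def)
  have "jacobian_mat d ?F ?x = 1\<^sub>m d"
  proof (rule eq_matI)
    fix i j assume "i < dim_row (1\<^sub>m d :: real mat)" "j < dim_col (1\<^sub>m d :: real mat)"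
    moreover have "deriv (\<lambda>t. t - 1) u = (1::real)" for u
      by (rule DERIV_imp_deriv) (auto intro!: derivative_eq_intros)
    ultimately show "jacobian_mat d ?F ?x $$ (i, j) = 1\<^sub>m d $$ (i, j)"
      by (cases "i = j") (simp_all add: jacobian_mat_def eval del: One_nat_def)
  qed (auto simp: jacobian_mat_def)
  moreover have "invertible_mat (1\<^sub>m d :: real mat)"
    by (auto simp: invertible_mat_def inverts_mat_def intro!: exI[of _ "1\<^sub>m d"])
  ultimately have "?x \<in> nondeg_pos_solutions d ?F"
    by (auto simp: nondeg_pos_solutions_def pos_orthant_def eval PiE_def extensional_def simp del: One_nat_def)
  then have "1 \<le> ecard (nondeg_pos_solutions d ?F)"
    by (auto simp: ecard_def one_enat_def Suc_le_eq card_gt_0_iff)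
  also have "\<dots> \<le> Xi d k"
    unfolding Xi_def using F by (rule SUP_upper)
  finally show ?thesis .
qed

subsection \<open>Fekete's lemma\<close>

lemma enat_root_ge_1:
  assumes "1 \<le> N"
  shows "1 \<le> enat_root m N"
  using assms by (cases N) (auto simp: enat_root_def one_enat_def one_ereal_def ge_one_powr_ge_zero)

text \<open>Split off \<open>m\<close> from the argument \<open>q\<close> times; what remains is a
  factor \<open>A r \<ge> 1\<close>.\<close>

lemma power_le_supermultiplicative:
  fixes A :: "nat \<Rightarrow> enat"
  assumes ge1: "\<And>n. 1 \<le> A n" and super: "\<And>m n. A m * A n \<le> A (m + n)"
  shows "A m ^ q \<le> A (m * q + r)"
proof (induction q)
  case (Suc q)
  have "A m ^ Suc q \<le> A m * A (m * q + r)"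
    using Suc by (simp add: mult_left_mono)
  also have "\<dots> \<le> A (m * Suc q + r)"
    using super[of m "m * q + r"] by (simp add: add.assoc)
  finally show ?case .
qed (simp add: ge1)

text \<open>Terms with \<open>n \<ge> 1\<close> never exceed the supremum. Conversely, if the term
  at \<open>m\<close> exceeds \<open>y\<close>, division of \<open>n\<close> by \<open>m\<close>
  bounds the term at \<open>n\<close> from below by a quantity tending to the term at
  \<open>m\<close>. Index 0 stays out of the supremum, as there is no root of order 0.\<close>

lemma supermultiplicative_root_tendsto_SUP:
  fixes A :: "nat \<Rightarrow> enat"
  assumes ge1: "\<And>n. 1 \<le> A n" and super: "\<And>m n. A m * A n \<le> A (m + n)" and "c > 0"
  shows "(\<lambda>n. enat_root (c * n) (A n)) \<longlonglongrightarrow> (SUP n\<in>{1..}. enat_root (c * n) (A n))"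
proof (rule order_tendstoI)
  fix y assume "y < (SUP n\<in>{1..}. enat_root (c * n) (A n))"
  then obtain m where m: "1 \<le> m" "y < enat_root (c * m) (A m)"
    by (auto simp: less_SUP_iff)
  show "\<forall>\<^sub>F n in sequentially. y < enat_root (c * n) (A n)"
  proof (cases "A m")
    case infinity
    \<comment> \<open>An infinite value propagates to all later indices because the cofactor
      \<open>A (n - m)\<close> is nonzero.\<close>
    have "A n = \<infinity>" if "m \<le> n" for n
    proof -
      have "A m * A (n - m) = \<infinity>"
        using ge1[of "n - m"] by (auto simp: infinity imult_is_infinity)
      then show ?thesis
        using super[of m "n - m"] that by simp
    qed
    then have "\<forall>\<^sub>F n in sequentially. A n = \<infinity>"
      by (auto simp: eventually_sequentially)
    then show ?thesis
      
    proof eventually_elim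
      case (elim n)
      then show ?case
        using m(2) by (simp add: enat_root_def infinity)
    qed
  next
    case (enat a)
    have a: "real a \<ge> 1"
      using ge1[of m] enat by (simp add: one_enat_def)
    \<comment> \<open>\<open>n div m \<ge> n/m - 1\<close>, divided by \<open>c n\<close>\<close>
    let ?e = "\<lambda>n. 1 / real (c * m) - 1 / real (c * n)"
    \<comment> \<open>Writing \<open>n\<close> as \<open>m * q + r\<close> gives
      \<open>a ^ q \<le> A n\<close>; then the root of order \<open>c * n\<close> is taken. As
      \<open>a \<ge> 1\<close>, the exponent may be decreased to \<open>?e n\<close>, even where
      that is negative.\<close>
    have lower: "ereal (real a powr ?e n) \<le> enat_root (c * n) (A n)" if "n \<ge> 1" for n
    proof (cases "A n")
      case (enat b)
      let ?q = "n div m"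
      have "A m ^ ?q \<le> A n"
        using power_le_supermultiplicative[of A m ?q "n mod m", OF ge1 super] by simp
      moreover have "enat a ^ q = enat (a ^ q)" for q
        by (induction q) (auto simp: one_enat_def)
      ultimately have ab: "a ^ ?q \<le> b"
        using \<open>A m = enat a\<close> enat by simp
      have "n \<le> m * ?q + m"
        using m(1) by (metis add_left_mono less_imp_le mod_less_divisor mult_div_mod_eq not_one_le_zero not_gr_zero)
      then have "real n \<le> real m * real ?q + real m"
        by (metis of_nat_add of_nat_le_iff of_nat_mult)
      then have "real n / real m - 1 \<le> real ?q"
        using m(1) by (simp add: field_simps)
      then have "(real n / real m - 1) / real (c * n) \<le> real ?q / real (c * n)"
        by (rule divide_right_mono) simp
      moreover have "(real n / real m - 1) / real (c * n) = ?e n"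
        using \<open>c > 0\<close> m(1) that by (simp add: field_simps)
      ultimately have "?e n \<le> real ?q / real (c * n)"
        by simp
      then have "real a powr ?e n \<le> real a powr (real ?q / real (c * n))"
        using a by (rule powr_mono)
      also have "\<dots> = (real a ^ ?q) powr (1 / real (c * n))"
        using a by (simp add: powr_realpow[symmetric] powr_powr)
      also have "\<dots> \<le> real b powr (1 / real (c * n))"
        using ab by (intro powr_mono2) (auto simp flip: of_nat_power)
      finally show ?thesis
        by (simp add: enat_root_def enat)
    qed (simp add: enat_root_def)
    \<comment> \<open>The exponent \<open>?e n\<close> tends to \<open>1 / (c * m)\<close>, so the
      lower bound tends to the term at \<open>m\<close>, which is greater than
      \<open>y\<close>.\<close>
    have "(\<lambda>n. 1 / real (c * n)) \<longlonglongrightarrow> 0"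
      using tendsto_mult[OF tendsto_const[of "1 / real c"] lim_1_over_n[where 'a = real]] by simp
    then have "(\<lambda>n. real a powr ?e n) \<longlonglongrightarrow> real a powr (1 / real (c * m) - 0)"
      using a by (intro tendsto_powr tendsto_diff tendsto_const) auto
    then have "(\<lambda>n. ereal (real a powr ?e n)) \<longlonglongrightarrow> enat_root (c * m) (A m)"
      by (simp add: enat_root_def enat)
    then have "\<forall>\<^sub>F n in sequentially. y < ereal (real a powr ?e n)"
      using m(2) by (rule order_tendstoD(1))
    then show ?thesis
      using eventually_ge_at_top[of 1]
    proof eventually_elim
      case (elim n)
      then show ?case
        using lower[of n] by (meson less_le_trans)
    qed
  qed
next
  fix y assume y: "(SUP n\<in>{1..}. enat_root (c * n) (A n)) < y"
  show "\<forall>\<^sub>F n in sequentially. enat_root (c * n) (A n) < y"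
    using eventually_ge_at_top[of 1]
  proof eventually_elim
    case (elim n)
    then have "enat_root (c * n) (A n) \<le> (SUP n\<in>{1..}. enat_root (c * n) (A n))"
      by (intro SUP_upper) simp
    with y show ?case
      by (rule le_less_trans[rotated])
  qed
qed

section \<open>The limit for the numbers of solutions\<close>

lemma Xi_root_seq_tendsto:
  assumes "d > 0"
  shows "Xi_root_seq d k \<longlonglongrightarrow> (SUP n\<in>{1..}. Xi_root_seq d k n)"
proof -
  have "Xi_root_seq d k = (\<lambda>n. enat_root ((d + k) * n) (Xi (d * n) (k * n)))"
    by (auto simp: Xi_root_seq_def algebra_simps)
  moreover have "Xi (d * m) (k * m) * Xi (d * n) (k * n) \<le> Xi (d * (m + n)) (k * (m + n))" for m n
    using Xi_supermultiplicative[of "d * m" "k * m" "d * n" "k * n"] by (simp add: distrib_left)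
  ultimately show ?thesis
    using supermultiplicative_root_tendsto_SUP[of "\<lambda>n. Xi (d * n) (k * n)" "d + k"] Xi_ge_1 assms
    by auto
qed

lemma xi_eq_SUP: "d > 0 \<Longrightarrow> xi d k = (SUP n\<in>{1..}. Xi_root_seq d k n)"
  unfolding xi_def by (intro limI Xi_root_seq_tendsto)

theorem theorem3:
  fixes d k :: nat
  assumes "d > 0" and "k > 0"
  shows "convergent (Xi_root_seq d k) \<and> 1 \<le> xi d k \<and>
    (\<forall>d' k'. d' > 0 \<longrightarrow> k' > 0 \<longrightarrow> real d / real k = real d' / real k' \<longrightarrow> xi d k = xi d' k') \<and>
    enat_root (d + k) (Xi d k) \<le> xi d k"
proof -
  have lim: "Xi_root_seq e l \<longlonglongrightarrow> xi e l" if "e > 0" for e l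
    using Xi_root_seq_tendsto[OF that] xi_eq_SUP[OF that] by simp
  \<comment> \<open>The limit is a supremum, hence at least the term at 1, which is the claimed
    lower bound.\<close>
  have "Xi_root_seq d k 1 \<le> xi d k"
    unfolding xi_eq_SUP[OF assms(1)] by (intro SUP_upper) simp
  then have root: "enat_root (d + k) (Xi d k) \<le> xi d k"
    by (simp add: Xi_root_seq_def)
  have "xi d k = xi d' k'" if "d' > 0" "k' > 0" and ratio: "real d / real k = real d' / real k'" for d' k'
  proof -
    have "real (k * d') = real (k' * d)"
      using ratio assms that(2) by (simp add: field_simps)
    then have "k * d' = k' * d"
      by (simp only: of_nat_eq_iff)
    then have "k * (d' * n) = k' * (d * n)" "d * (d' * n) = d' * (d * n)" for n
      by (metis mult.assoc) (rule mult.left_commute)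
    \<comment> \<open>Equal ratios mean \<open>k * d' = k' * d\<close>, so index
      \<open>d' * n\<close> for \<open>(d, k)\<close> and index \<open>d * n\<close> for
      \<open>(d', k')\<close> yield the same pair of arguments of \<open>Xi\<close>. This is the
      common subsequence.\<close>
    then have eq: "Xi_root_seq d k \<circ> (\<lambda>n. d' * n) = Xi_root_seq d' k' \<circ> (\<lambda>n. d * n)"
      by (simp only: fun_eq_iff o_apply Xi_root_seq_def) simp
    have "(Xi_root_seq d k \<circ> (\<lambda>n. d' * n)) \<longlonglongrightarrow> xi d k"
      by (rule LIMSEQ_subseq_LIMSEQ[OF lim]) (use assms that in \<open>auto simp: strict_mono_def\<close>)
    moreover have "(Xi_root_seq d' k' \<circ> (\<lambda>n. d * n)) \<longlonglongrightarrow> xi d' k'"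
      by (rule LIMSEQ_subseq_LIMSEQ[OF lim]) (use assms that in \<open>auto simp: strict_mono_def\<close>)
    ultimately show ?thesis
      unfolding eq by (rule LIMSEQ_unique)
  qed
  moreover have "convergent (Xi_root_seq d k)"
    using lim[OF assms(1)] by (auto simp: convergent_def)
  moreover have "1 \<le> xi d k"
    using enat_root_ge_1[OF Xi_ge_1, of "d + k" d k] root by (rule order_trans)
  ultimately show ?thesis
    using root by blast
qed

end
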